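(* Let $m,n\ge 1$, let $\mathbf{y}_i=(y^i_1,\dots,y^i_n)\in\mathbb{R}^n$ ($i=1,\dots,m$) be fixed points and let $k_1,\dots,k_m>0$ be weights. Let $\mathbf{F}=(x_1,\dots,x_n)\in\mathbb{R}^n$ be such that for every $j=1,\dots,n$ $$\sum_{i:\,y^i_j<x_j}k_i-\sum_{i:\,y^i_j\ge x_j}k_i\le 0\qquad\text{and}\qquad \sum_{i:\,y^i_j\le x_j}k_i-\sum_{i:\,y^i_j> x_j}k_i\ge 0 .$$ Then $\mathbf{F}$ is a Fermat point in the Manhattan norm, i.e. $\mathbf{F}$ minimizes over $\mathbb{R}^n$ the function $$f(x_1,\dots,x_n)=\sum_{i=1}^m\sum_{j=1}^n k_i\,|y^i_j-x_j| .$$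
   Context: The Manhattan norm ($\mathcal{L}^1$ norm) distance on $\mathbb{R}^n$ is $\|\mathbf{x}-\mathbf{y}\|_1=\sum_{i=1}^n|x_i-y_i|$. A Fermat point in this norm, for points $\mathbf{y}_1,\dots,\mathbf{y}_m$ with positive weights $k_1,\dots,k_m$, is a point minimizing the weighted sum of $\mathcal{L}^1$ distances to the given points. The two displayed quantities are, respectively, the left and right derivatives at $x_j$ of the one-variable function $t\mapsto\sum_{i=1}^m k_i|y^i_j-t|$. *)

theory Defs
  imports "HOL-Analysis.Analysis"
begin

definition manhattan_norm :: "real ^ 'n \<Rightarrow> real"
  where "manhattan_norm x = (\<Sum>j\<in>UNIV. \<bar>x $ j\<bar>)"

text \<open>The points \<open>y 1, \<dots>, y m\<close> and weights \<open>k 1, \<dots>, k m\<close> are given as functions on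
  \<open>nat\<close>; values outside \<open>{1..m}\<close> are irrelevant.\<close>

definition manhattan_fermat_point ::
    "nat \<Rightarrow> (nat \<Rightarrow> real) \<Rightarrow> (nat \<Rightarrow> real ^ 'n) \<Rightarrow> real ^ 'n \<Rightarrow> bool"
  where "manhattan_fermat_point m k y F \<longleftrightarrow>
    is_arg_min (\<lambda>x. \<Sum>i=1..m. k i * manhattan_norm (y i - x)) (\<lambda>_. True) F"

end

(* The objective splits into one-variable functions, one per coordinate, each convex; the
   hypotheses say that its left derivative at x_j is at most 0 and its right derivative at
   least 0.  Choosing a subgradient of every |y_j - t| at x_j according to the side on which
   the competitor lies gives a weighted sum of tangent inequalities that proves minimality. *)
theory Submission
  imports Defs
begin

text \<open>Bridges two forms of a one-sided derivative: a weighted sum of slopes 1 and -1, and the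
  difference of weights used in the hypotheses.\<close>

lemma sum_signed_split:
  fixes w :: "'i \<Rightarrow> real"
  assumes "finite I"
  shows "(\<Sum>i\<in>I. w i * (if P i then 1 else - 1)) =
    (\<Sum>i | i \<in> I \<and> P i. w i) - (\<Sum>i | i \<in> I \<and> \<not> P i. w i)"
proof -
  have "(\<Sum>i\<in>I. w i * (if P i then 1 else - 1)) =
    (\<Sum>i\<in>I. (if P i then w i else 0) - (if \<not> P i then w i else 0))"
    by (intro sum.cong) auto
  also have "\<dots> = (\<Sum>i\<in>I. if P i then w i else 0) - (\<Sum>i\<in>I. if \<not> P i then w i else 0)"
    by (rule sum_subtractf)
  finally show ?thesis
    using assms by (simp add: sum.inter_filter)
qed

text \<open>The problem of a single coordinate. \<open>left\<close> and \<open>right\<close> say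
  that the weight strictly below \<open>c\<close> is at most half of the total, and the weight up to
  \<open>c\<close> at least half.\<close>

lemma weighted_median_minimizes:
  fixes a w :: "'i \<Rightarrow> real" and c t :: real
  assumes "finite I" and nonneg: "\<And>i. i \<in> I \<Longrightarrow> w i \<ge> 0"
    and left: "(\<Sum>i | i \<in> I \<and> a i < c. w i) - (\<Sum>i | i \<in> I \<and> a i \<ge> c. w i) \<le> 0"
    and right: "(\<Sum>i | i \<in> I \<and> a i \<le> c. w i) - (\<Sum>i | i \<in> I \<and> a i > c. w i) \<ge> 0"
  shows "(\<Sum>i\<in>I. w i * \<bar>a i - c\<bar>) \<le> (\<Sum>i\<in>I. w i * \<bar>a i - t\<bar>)"
proof -
  \<comment> \<open>The derivative of |\<open>a i\<close> - x| at x = \<open>c\<close> from the side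
    of \<open>t\<close>. The side matters only for ties \<open>a i = c\<close>, which get slope 1
    towards the right and -1 towards the left.\<close>
  define s where "s i = (if (if c \<le> t then a i \<le> c else a i < c) then 1 else - 1 :: real)" for i
  have "(\<Sum>i\<in>I. w i * s i) * (t - c) \<ge> 0"
  proof (cases "c \<le> t")
    case True
    then have "(\<Sum>i\<in>I. w i * s i) \<ge> 0"
      using right sum_signed_split[OF \<open>finite I\<close>, of w "\<lambda>i. a i \<le> c"]
      by (simp add: s_def not_le)
    with True show ?thesis by simp
  next
    case False
    then have "(\<Sum>i\<in>I. w i * s i) \<le> 0"
      using left sum_signed_split[OF \<open>finite I\<close>, of w "\<lambda>i. a i < c"]
      by (simp add: s_def not_less)
    with False show ?thesis by (simp add: mult_nonpos_nonpos)
  qed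
  moreover have "(\<Sum>i\<in>I. w i * \<bar>a i - c\<bar>) + (\<Sum>i\<in>I. w i * s i) * (t - c) =
      (\<Sum>i\<in>I. w i * (\<bar>a i - c\<bar> + s i * (t - c)))"
    by (simp add: sum_distrib_right sum.distrib distrib_left mult.assoc)
  moreover have "\<dots> \<le> (\<Sum>i\<in>I. w i * \<bar>a i - t\<bar>)"
  proof (intro sum_mono mult_left_mono)
    \<comment> \<open>\<open>s i\<close> is a subgradient of \<open>\<lambda>x. \<bar>a i - x\<bar>\<close> at \<open>c\<close>.\<close>
    show "\<bar>a i - c\<bar> + s i * (t - c) \<le> \<bar>a i - t\<bar>" for i
      by (auto simp: s_def)
  qed (rule nonneg)
  ultimately show ?thesis by linarith
qed

theorem mainTheorem1:
  fixes m :: nat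
    and y :: "nat \<Rightarrow> real ^ 'n"
    and k :: "nat \<Rightarrow> real"
    and F :: "real ^ 'n"
  assumes "m \<ge> 1"
    and "\<And>i. i \<in> {1..m} \<Longrightarrow> k i > 0"
    and "\<And>j. (\<Sum>i | i \<in> {1..m} \<and> y i $ j < F $ j. k i)
              - (\<Sum>i | i \<in> {1..m} \<and> y i $ j \<ge> F $ j. k i) \<le> 0"
    and "\<And>j. (\<Sum>i | i \<in> {1..m} \<and> y i $ j \<le> F $ j. k i)
              - (\<Sum>i | i \<in> {1..m} \<and> y i $ j > F $ j. k i) \<ge> 0"
  shows "manhattan_fermat_point m k y F
    \<and> is_arg_min (\<lambda>x. \<Sum>i=1..m. \<Sum>j\<in>UNIV. k i * \<bar>y i $ j - x $ j\<bar>) (\<lambda>_. True) F"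
proof -
  let ?f = "\<lambda>x :: real ^ 'n. \<Sum>i=1..m. \<Sum>j\<in>UNIV. k i * \<bar>y i $ j - x $ j\<bar>"
  have "?f F \<le> ?f x" for x
  proof -
    have "(\<Sum>i=1..m. k i * \<bar>y i $ j - F $ j\<bar>) \<le> (\<Sum>i=1..m. k i * \<bar>y i $ j - x $ j\<bar>)" for j
      using assms(2-4) by (intro weighted_median_minimizes) (auto intro: less_imp_le)
    then have "(\<Sum>j\<in>UNIV. \<Sum>i=1..m. k i * \<bar>y i $ j - F $ j\<bar>) \<le>
        (\<Sum>j\<in>UNIV. \<Sum>i=1..m. k i * \<bar>y i $ j - x $ j\<bar>)"
      by (rule sum_mono)
    then show ?thesis
      \<comment> \<open>Fixing one index set as \<open>{1..m}\<close> lets the swap rewrite in one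
        direction only, so it cannot loop.\<close>
      by (simp only: sum.swap[of _ "{1..m}"])
  qed
  then have "is_arg_min ?f (\<lambda>_. True) F"
    by (simp add: is_arg_min_linorder)
  then show ?thesis
    by (simp add: manhattan_fermat_point_def manhattan_norm_def sum_distrib_left)
qed

end
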